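(* Let $n,k,r$ be positive integers and $p,b$ non-negative integers with $r\le p+1$. Put $$D(n,k,r,b,p)=\det\left(\binom{(n-i+1)p+b-i+j+k+(i-1)r}{k+(i-1)r}\right)_{1\le i,j\le n+1}.$$ Then $$D(n,k,r,b,p)=\prod_{(i,j)\in\mathcal{A}_{n,k,r}}\frac{i+b+jp}{i}\ \prod_{(i,j)\in\mathcal{B}_{n,k,r}}\frac{(k-i+1)(p+1)+(i+j-1)r+r(b+np)}{k-i+1+(i+j-1)r},$$ where $$\mathcal{A}_{n,k,r}=\{(i,j)\in\mathbb{Z}_{\ge0}^2\ |\ j\le n,\ j<i\le k+(r-1)(n-j)\},$$ $$\mathcal{B}_{n,k,r}=\{(i,j)\in\mathbb{Z}_{\ge1}^2\ |\ i+j\le n+1,\ i\ne k+1+rs\ \text{for all}\ s\in\mathbb{Z}_{\ge0}\}.$$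
   Context: Binomial coefficients $\binom{a}{c}$ with $0\le a<c$ are zero. (The number $D(n,k,r,b,p)$ is the value at $x_1=x_2=\cdots=1$ of the Schubert polynomial of the unique vexillary permutation with shape $\lambda_i=(n-i+1)p+b$ and flag $\phi_i=k+1+r(i-1)$, $1\le i\le n+1-\delta_{b,0}$.) *)

theory Defs
  imports "Jordan_Normal_Form.Determinant"
begin

text \<open>
  All parameters are natural numbers. Truncated subtraction is harmless where it is used:
  \<open>i - 1\<close> only matters for \<open>i \<ge> 1\<close>, and \<open>n - j\<close>, \<open>r - 1\<close> only for \<open>j \<le> n\<close>, \<open>r \<ge> 1\<close>.
  The upper binomial argument is computed in the integers; by \<open>upper_arg_nonneg\<close> below
  it is non-negative on the index range of the determinant, so \<open>nat\<close> never truncates there.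
\<close>

definition upper_arg :: "nat \<Rightarrow> nat \<Rightarrow> nat \<Rightarrow> nat \<Rightarrow> nat \<Rightarrow> nat \<Rightarrow> nat \<Rightarrow> int" where
  "upper_arg n k r b p i j =
     (int n - int i + 1) * int p + int b - int i + int j + int k + (int i - 1) * int r"

definition lower_arg :: "nat \<Rightarrow> nat \<Rightarrow> nat \<Rightarrow> nat" where
  "lower_arg k r i = k + (i - 1) * r"

lemma upper_arg_nonneg:
  assumes "1 \<le> r" "1 \<le> i" "i \<le> n + 1" "1 \<le> j"
  shows "0 \<le> upper_arg n k r b p i j"
proof -
  have 1: "0 \<le> (int n - int i + 1) * int p"
    using assms by (intro mult_nonneg_nonneg) auto
  have 2: "(int i - 1) * 1 \<le> (int i - 1) * int r"
    using assms by (intro mult_left_mono) auto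
  have aux: "0 \<le> X + int b' - int i' + int j' + int k' + Y"
    if "0 \<le> X" "int i' - 1 \<le> Y" "1 \<le> j'" for X Y and i' j' b' k' :: nat
    using that by linarith
  show ?thesis
    unfolding upper_arg_def
    using 1 2 assms(4) aux[of "(int n - int i + 1) * int p" i "(int i - 1) * int r" j b k]
    by simp
qed

text \<open>Matrix positions in \<open>mat\<close> are counted from 0, hence the shift by one.\<close>

definition D :: "nat \<Rightarrow> nat \<Rightarrow> nat \<Rightarrow> nat \<Rightarrow> nat \<Rightarrow> rat" where
  "D n k r b p =
     det (mat (n + 1) (n + 1)
       (\<lambda>(i, j). of_nat (nat (upper_arg n k r b p (i + 1) (j + 1)) choose lower_arg k r (i + 1))))"

definition \<A> :: "nat \<Rightarrow> nat \<Rightarrow> nat \<Rightarrow> (nat \<times> nat) set" where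
  "\<A> n k r = {(i, j). j \<le> n \<and> j < i \<and> i \<le> k + (r - 1) * (n - j)}"

definition \<B> :: "nat \<Rightarrow> nat \<Rightarrow> nat \<Rightarrow> (nat \<times> nat) set" where
  "\<B> n k r = {(i, j). 1 \<le> i \<and> 1 \<le> j \<and> i + j \<le> n + 1 \<and> (\<forall>s. i \<noteq> k + 1 + r * s)}"

lemma finite_\<A>: "finite (\<A> n k r)"
proof (rule finite_subset)
  show "\<A> n k r \<subseteq> {..k + (r - 1) * n} \<times> {..n}"
  proof
    fix x assume "x \<in> \<A> n k r"
    then obtain i j where x: "x = (i, j)" "j \<le> n" "i \<le> k + (r - 1) * (n - j)"
      by (auto simp: \<A>_def)
    have "(r - 1) * (n - j) \<le> (r - 1) * n" by (rule mult_le_mono2) simp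
    then have "i \<le> k + (r - 1) * n" using x(3) by linarith
    with x show "x \<in> {..k + (r - 1) * n} \<times> {..n}" by blast
  qed
qed simp

lemma finite_\<B>: "finite (\<B> n k r)"
  by (rule finite_subset[of _ "{..n + 1} \<times> {..n + 1}"]) (auto simp: \<B>_def)

end

theory Submission
  imports Defs
begin

text \<open>
  Count rows and columns from \<open>0\<close> and put \<open>l\<^sub>i = k + i r\<close>, \<open>w\<^sub>i = (n - i)(p + 1) + b\<close> and
  \<open>a\<^sub>i = w\<^sub>i + l\<^sub>i - n\<close>, so that the entry in row \<open>i\<close> and column \<open>j\<close> is the binomial coefficient
  of \<open>a\<^sub>i + j\<close> over \<open>l\<^sub>i\<close>. Vandermonde's convolution factors out a unitriangular matrix
  and leaves the binomial coefficients of \<open>a\<^sub>i\<close> over \<open>l\<^sub>i - j\<close>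
  (\<open>choose_shift_expansion\<close>). After extracting \<open>a\<^sub>i! / (l\<^sub>i! w\<^sub>i!)\<close> from row \<open>i\<close>, what remains is
  a product of \<open>n\<close> linear forms in \<open>i\<close>
  (\<open>binomial_as_linear_forms\<close>): with \<open>f\<^sub>t(x) = r x + k - t\<close> and
  \<open>g\<^sub>t(x) = b + n p + t - (p + 1) x\<close>, column \<open>j\<close> is the polynomial
  \<open>f\<^sub>0 \<cdots> f\<^sub>j\<^sub>-\<^sub>1 g\<^sub>j\<^sub>+\<^sub>1 \<cdots> g\<^sub>n\<close> evaluated at \<open>x = i\<close>.

  Krattenthaler's evaluation (\<open>det_mat_linear_forms\<close>) says that the determinant of such a matrix
  is the Vandermonde product of the evaluation points times the product over \<open>s < t\<close> of the
  resultants of \<open>f\<^sub>s\<close> and \<open>g\<^sub>t\<close>. It follows by expanding \<open>g\<^sub>j\<^sub>+\<^sub>1 \<cdots> g\<^sub>n\<close> in the Newton basis at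
  the roots of \<open>f\<^sub>j, f\<^sub>j\<^sub>+\<^sub>1, \<dots>\<close>, which yields a triangular factor. Here the resultant is
  \<open>r (b + n p + t) + (p + 1)(k - s)\<close>, the numerator of the second product of the theorem at
  \<open>(i, j) = (s + 1, t - s)\<close>.

  It remains to compare products. The pairs \<open>s < t\<close> which \<open>\<B>\<close> omits are those with
  \<open>s = k + r m\<close>; there the numerator and the denominator are \<open>r ((n - m) p + b + (t - m))\<close> and
  \<open>r (t - m)\<close>. Written in terms of \<open>i = t - m\<close>, for each \<open>m\<close> these omitted factors
  and the factors of \<open>\<A>\<close> with \<open>j = n - m\<close> are the same expression over the opposite ranges
  \<open>{U<..n - m}\<close> and \<open>{n - m<..U}\<close>, where \<open>U = k + (r - 1) m\<close>. One of the two ranges is empty,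
  and in either case the quotient is a ratio of factorials (\<open>prod_telescope_fact\<close>).
\<close>

section \<open>Determinants given by entry functions\<close>

lemma det_mat_factor:
  fixes g h :: "nat \<Rightarrow> nat \<Rightarrow> 'a::comm_ring_1"
  assumes "\<And>i j. i < N \<Longrightarrow> j < N \<Longrightarrow> f i j = (\<Sum>t<N. g i t * h t j)"
  shows "det (mat N N (\<lambda>(i, j). f i j)) =
    det (mat N N (\<lambda>(i, j). g i j)) * det (mat N N (\<lambda>(i, j). h i j))"
proof -
  have "mat N N (\<lambda>(i, j). f i j) = mat N N (\<lambda>(i, j). g i j) * mat N N (\<lambda>(i, j). h i j)"
    using assms by (intro eq_matI) (auto simp: scalar_prod_def lessThan_atLeast0)
  then show ?thesis
    by (simp add: det_mult[of _ N])
qed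

lemma det_mat_upper_triangular:
  fixes f :: "nat \<Rightarrow> nat \<Rightarrow> 'a::comm_ring_1"
  assumes "\<And>i j. j < i \<Longrightarrow> i < N \<Longrightarrow> f i j = 0"
  shows "det (mat N N (\<lambda>(i, j). f i j)) = (\<Prod>i<N. f i i)"
  using assms
  by (subst det_upper_triangular[of _ N])
    (auto simp: upper_triangular_def prod_list_diag_prod lessThan_atLeast0 intro!: prod.cong)

lemma det_mat_lower_triangular:
  fixes f :: "nat \<Rightarrow> nat \<Rightarrow> 'a::comm_ring_1"
  assumes "\<And>i j. i < j \<Longrightarrow> j < N \<Longrightarrow> f i j = 0"
  shows "det (mat N N (\<lambda>(i, j). f i j)) = (\<Prod>i<N. f i i)"
  using assms
  by (subst det_lower_triangular[of N])
    (auto simp: prod_list_diag_prod lessThan_atLeast0 intro!: prod.cong)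

lemma det_mat_scale_rows:
  fixes f :: "nat \<Rightarrow> nat \<Rightarrow> 'a::comm_ring_1"
  shows "det (mat N N (\<lambda>(i, j). z i * f i j)) = (\<Prod>i<N. z i) * det (mat N N (\<lambda>(i, j). f i j))"
proof -
  have "det (mat N N (\<lambda>(i, j). z i * f i j)) =
      det (mat N N (\<lambda>(i, j). if i = j then z i else 0)) * det (mat N N (\<lambda>(i, j). f i j))"
  proof (rule det_mat_factor)
    fix i j assume "i < N" "j < N"
    have "(\<Sum>t<N. (if i = t then z i else 0) * f t j) = (\<Sum>t<N. if i = t then z i * f t j else 0)"
      by (rule sum.cong) auto
    with \<open>i < N\<close> show "z i * f i j = (\<Sum>t<N. (if i = t then z i else 0) * f t j)"
      by simp
  qed
  then show ?thesis
    by (subst (asm) det_mat_upper_triangular) auto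
qed

section \<open>Determinants of products of linear forms\<close>

text \<open>
  Newton interpolation with arbitrary, possibly repeated nodes \<open>\<rho> 0, \<rho> 1, \<dots>\<close>. Only the two extreme
  coefficients are recorded: they become the diagonal entries of triangular matrices below.
\<close>
lemma newton_expansion:
  fixes P :: "'a::field poly"
  assumes "degree P \<le> d"
  obtains c where "\<And>x. poly P x = (\<Sum>m\<le>d. c m * (\<Prod>t<m. x - \<rho> t))"
    and "c 0 = poly P (\<rho> 0)" and "c d = coeff P d"
proof -
  have "\<exists>c. (\<forall>x. poly P x = (\<Sum>m\<le>d. c m * (\<Prod>t<m. x - \<rho> t))) \<and>
      c 0 = poly P (\<rho> 0) \<and> c d = coeff P d"
    using assms
  proof (induction d arbitrary: P \<rho>)
    case 0
    then obtain a where "P = [:a:]" by (metis degree_eq_zeroE le_zero_eq)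
    then show ?case by (intro exI[of _ "\<lambda>_. a"]) simp
  next
    case (Suc d)
    define Q where "Q = synthetic_div P (\<rho> 0)"
    have P: "P = [:poly P (\<rho> 0):] + [:- \<rho> 0, 1:] * Q"
      unfolding Q_def by (metis synthetic_div_correct' add.commute)
    have "degree Q \<le> d"
      using Suc.prems by (simp add: Q_def degree_synthetic_div)
    from Suc.IH[OF this, of "\<lambda>t. \<rho> (Suc t)"] obtain c
      where c: "\<And>x. poly Q x = (\<Sum>m\<le>d. c m * (\<Prod>t<m. x - \<rho> (Suc t)))" "c d = coeff Q d"
      by blast
    define c' where "c' = case_nat (poly P (\<rho> 0)) c"
    have "poly P x = (\<Sum>m\<le>Suc d. c' m * (\<Prod>t<m. x - \<rho> t))" for x
    proof -
      have "poly P x = poly P (\<rho> 0) + (x - \<rho> 0) * poly Q x"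
        using arg_cong[OF P, of "\<lambda>q. poly q x"] by (simp add: algebra_simps)
      then show ?thesis
        unfolding c(1) sum.atMost_Suc_shift
        by (simp add: c'_def prod.lessThan_Suc_shift sum_distrib_left mult_ac left_diff_distrib[symmetric]
            del: prod.lessThan_Suc)
    qed
    moreover have "coeff P (Suc d) = coeff Q d"
    proof -
      have "coeff Q (Suc d) = 0"
        using \<open>degree Q \<le> d\<close> by (simp add: coeff_eq_0)
      then show ?thesis
        using arg_cong[OF P, of "\<lambda>q. coeff q (Suc d)"] by simp
    qed
    moreover have "c' 0 = poly P (\<rho> 0)" "c' (Suc d) = c d"
      by (simp_all add: c'_def)
    ultimately show ?case
      using c(2) by metis
  qed
  with that show thesis by blast
qed

text \<open>
  A Vandermonde determinant with the Newton basis at \<open>\<rho>\<close> in place of the monomials. Its value does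
  not depend on \<open>\<rho>\<close>: changing the nodes to the evaluation points themselves is unitriangular and
  makes the matrix lower triangular.
\<close>
lemma det_mat_monic_prods:
  fixes x \<rho> :: "nat \<Rightarrow> 'a::field"
  shows "det (mat N N (\<lambda>(i, j). \<Prod>t<j. x i - \<rho> t)) = (\<Prod>i<N. \<Prod>s<i. x i - x s)"
proof -
  have "\<exists>c. (\<forall>y. (\<Prod>t<j. y - \<rho> t) = (\<Sum>m\<le>j. c m * (\<Prod>t<m. y - x t))) \<and> c j = 1" for j
  proof -
    define P where "P = (\<Prod>t<j. [:- \<rho> t, 1:])"
    have deg: "degree P = j"
      by (simp add: P_def degree_prod_eq_sum_degree)
    have "coeff P j = 1"
      using lead_coeff_prod[of "\<lambda>t. [:- \<rho> t, 1:]" "{..<j}"] deg by (simp add: P_def)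
    moreover have "poly P y = (\<Prod>t<j. y - \<rho> t)" for y
      by (simp add: P_def poly_prod)
    ultimately show ?thesis
      using newton_expansion[of P j x] deg by (metis order_refl)
  qed
  then obtain c where c: "\<And>j y. (\<Prod>t<j. y - \<rho> t) = (\<Sum>m\<le>j. c j m * (\<Prod>t<m. y - x t))"
    and c1: "\<And>j. c j j = 1"
    by metis
  have "det (mat N N (\<lambda>(i, j). \<Prod>t<j. x i - \<rho> t)) =
      det (mat N N (\<lambda>(i, j). \<Prod>t<j. x i - x t)) *
      det (mat N N (\<lambda>(i, j). if i \<le> j then c j i else 0))"
  proof (rule det_mat_factor)
    fix i j assume "j < N"
    then show "(\<Prod>t<j. x i - \<rho> t) = (\<Sum>m<N. (\<Prod>t<m. x i - x t) * (if m \<le> j then c j m else 0))"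
      unfolding c by (intro sum.mono_neutral_cong_left) auto
  qed
  also have "det (mat N N (\<lambda>(i, j). if i \<le> j then c j i else 0)) = 1"
    by (subst det_mat_upper_triangular) (auto simp: c1)
  also have "det (mat N N (\<lambda>(i, j). \<Prod>t<j. x i - x t)) = (\<Prod>i<N. \<Prod>s<i. x i - x s)"
    by (rule det_mat_lower_triangular) auto
  finally show ?thesis by simp
qed

text \<open>
  Krattenthaler's determinant. The numbers \<open>a * v t + e * u s\<close> are the resultants of the linear forms
  \<open>a * X + u s\<close> and \<open>v t - e * X\<close>.
\<close>
lemma det_mat_linear_forms:
  fixes x u v :: "nat \<Rightarrow> 'a::field"
  assumes "a \<noteq> 0"
  shows "det (mat (Suc n) (Suc n)
      (\<lambda>(i, j). (\<Prod>t<j. a * x i + u t) * (\<Prod>t\<in>{j<..n}. v t - e * x i))) =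
    (\<Prod>i\<le>n. \<Prod>s<i. x i - x s) * (\<Prod>s\<le>n. \<Prod>t\<in>{s<..n}. a * v t + e * u s)"
proof -
  define \<rho> where "\<rho> t = - u t / a" for t
  \<comment> \<open>The nodes start at the root of form number \<open>j\<close>, so that the Newton basis continues the product
    of the first \<open>j\<close> forms in column \<open>j\<close>.\<close>
  have "\<exists>c. (\<forall>y. (\<Prod>t\<in>{j<..n}. v t - e * y) = (\<Sum>m\<le>n - j. c m * (\<Prod>t<m. y - \<rho> (j + t)))) \<and>
      c 0 = (\<Prod>t\<in>{j<..n}. v t - e * \<rho> j)" for j
  proof -
    define P where "P = (\<Prod>t\<in>{j<..n}. [:v t, - e:])"
    have "degree P \<le> (\<Sum>t\<in>{j<..n}. degree [:v t, - e:])"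
      unfolding P_def using degree_prod_sum_le[of "{j<..n}" "\<lambda>t. [:v t, - e:]"] by (simp add: o_def)
    also have "\<dots> \<le> (\<Sum>t\<in>{j<..n}. 1)"
      by (intro sum_mono) simp
    finally have deg: "degree P \<le> n - j" by simp
    have ev: "poly P y = (\<Prod>t\<in>{j<..n}. v t - e * y)" for y
      by (simp add: P_def poly_prod mult.commute)
    show ?thesis
      by (rule newton_expansion[OF deg, of "\<lambda>t. \<rho> (j + t)"]) (auto simp: ev)
  qed
  then obtain c where
    c: "\<And>j y. (\<Prod>t\<in>{j<..n}. v t - e * y) = (\<Sum>m\<le>n - j. c j m * (\<Prod>t<m. y - \<rho> (j + t)))"
    and c0: "\<And>j. c j 0 = (\<Prod>t\<in>{j<..n}. v t - e * \<rho> j)"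
    by metis
  have "det (mat (Suc n) (Suc n)
        (\<lambda>(i, j). (\<Prod>t<j. a * x i + u t) * (\<Prod>t\<in>{j<..n}. v t - e * x i))) =
      det (mat (Suc n) (Suc n) (\<lambda>(i, j). \<Prod>t<j. x i - \<rho> t)) *
      det (mat (Suc n) (Suc n) (\<lambda>(i, j). if j \<le> i then a ^ j * c j (i - j) else 0))"
  proof (rule det_mat_factor)
    fix i j assume "j < Suc n"
    have "(\<Prod>t<j. a * x i + u t) = a ^ j * (\<Prod>t<j. x i - \<rho> t)"
    proof -
      have "a * x i + u t = a * (x i - \<rho> t)" for t
        using assms by (simp add: \<rho>_def field_simps)
      then show ?thesis by (simp add: prod.distrib)
    qed
    moreover have "(\<Prod>t<j. x i - \<rho> t) * (\<Prod>t<m. x i - \<rho> (j + t)) = (\<Prod>t<j + m. x i - \<rho> t)" for m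
      by (induction m) (simp_all add: mult.assoc[symmetric])
    ultimately have "(\<Prod>t<j. a * x i + u t) * (\<Prod>t\<in>{j<..n}. v t - e * x i) =
        (\<Sum>m\<le>n - j. (\<Prod>t<j + m. x i - \<rho> t) * (a ^ j * c j m))"
      by (simp add: c sum_distrib_left mult_ac)
    also have "\<dots> = (\<Sum>m\<in>{j..n}. (\<Prod>t<m. x i - \<rho> t) * (a ^ j * c j (m - j)))"
      using \<open>j < Suc n\<close>
      by (intro sum.reindex_bij_witness[of _ "\<lambda>m. m - j" "\<lambda>m. j + m"]) auto
    also have "\<dots> = (\<Sum>m<Suc n. (\<Prod>t<m. x i - \<rho> t) * (if j \<le> m then a ^ j * c j (m - j) else 0))"
      by (intro sum.mono_neutral_cong_left) auto
    finally show "(\<Prod>t<j. a * x i + u t) * (\<Prod>t\<in>{j<..n}. v t - e * x i) = \<dots>" .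
  qed
  also have "det (mat (Suc n) (Suc n) (\<lambda>(i, j). if j \<le> i then a ^ j * c j (i - j) else 0)) =
      (\<Prod>j\<le>n. a ^ j * (\<Prod>t\<in>{j<..n}. v t - e * \<rho> j))"
    by (subst det_mat_lower_triangular) (auto simp: c0 lessThan_Suc_atMost)
  also have "\<dots> = (\<Prod>s\<le>n. \<Prod>t\<in>{s<..n}. a) * (\<Prod>s\<le>n. \<Prod>t\<in>{s<..n}. v t - e * \<rho> s)"
  proof -
    \<comment> \<open>Each pair \<open>s < t\<close> receives one factor \<open>a\<close>, whether counted from \<open>t\<close> or from \<open>s\<close>.\<close>
    have "(\<Prod>j\<le>n. a ^ j) = (\<Prod>j\<le>n. a ^ (n - j))"
      by (rule prod.reindex_bij_witness[of _ "\<lambda>j. n - j" "\<lambda>j. n - j"]) auto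
    then show ?thesis by (simp add: prod.distrib)
  qed
  also have "\<dots> = (\<Prod>s\<le>n. \<Prod>t\<in>{s<..n}. a * v t + e * u s)"
  proof -
    have "a * (v t - e * \<rho> s) = a * v t + e * u s" for s t
      using assms by (simp add: \<rho>_def field_simps)
    then show ?thesis by (simp only: prod.distrib[symmetric])
  qed
  finally show ?thesis
    by (simp only: det_mat_monic_prods lessThan_Suc_atMost)
qed

section \<open>Evaluating the determinant\<close>

lemma prod_falling_nat:
  "(\<Prod>u<m. of_nat N - of_nat u) =
    (if m \<le> N then fact N / fact (N - m) else (0 :: 'a::field_char_0))"
proof (induction m)
  case (Suc m)
  show ?case
  proof (cases "Suc m \<le> N")
    case True
    then have "fact (N - m) = (of_nat N - of_nat m) * (fact (N - Suc m) :: 'a)"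
      by (metis Suc_diff_Suc Suc_le_eq fact_Suc of_nat_diff less_imp_le)
    with True Suc show ?thesis by simp
  next
    case False
    then show ?thesis using Suc by (cases "m = N") auto
  qed
qed simp

text \<open>
  The right-hand side also vanishes when \<open>j > l\<close> or \<open>l - j > a\<close>: in the first case the first product
  contains the factor \<open>l - l\<close>, in the second case \<open>n - j > w\<close> and the second product contains
  the factor with \<open>t = n - w\<close>.
\<close>
lemma binomial_as_linear_forms:
  fixes a l w n j :: nat
  assumes "a + n = w + l" and "j \<le> n"
  shows "of_nat (if j \<le> l then a choose (l - j) else 0) =
    fact a / (fact l * fact w) *
    ((\<Prod>t<j. of_nat l - of_nat t) * (\<Prod>t\<in>{j<..n}. of_nat w + of_nat t - of_nat n) :: 'a::field_char_0)"
proof -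
  have "(\<Prod>t\<in>{j<..n}. of_nat w + of_nat t - of_nat n) = (\<Prod>u<n - j. of_nat w - of_nat u :: 'a)"
    by (rule prod.reindex_bij_witness[of _ "\<lambda>u. n - u" "\<lambda>t. n - t"]) (auto simp:)
  then have R: "(\<Prod>t<j. of_nat l - of_nat t) * (\<Prod>t\<in>{j<..n}. of_nat w + of_nat t - of_nat n) =
      (if j \<le> l then fact l / fact (l - j) else 0) *
      (if n - j \<le> w then fact w / fact (w - (n - j)) else (0 :: 'a))"
    by (simp add: prod_falling_nat)
  show ?thesis
  proof (cases "j \<le> l \<and> n - j \<le> w")
    case True
    then have "l - j \<le> a" "a - (l - j) = w - (n - j)"
      using assms by linarith+
    with True show ?thesis
      unfolding R by (simp add: binomial_fact)
  next
    case False
    then have "\<not> j \<le> l \<or> a < l - j"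
      using assms by linarith
    with False show ?thesis
      unfolding R by auto
  qed
qed

text \<open>
  The first factor depends on \<open>a\<close> and \<open>l\<close> only and the second on \<open>j\<close> only, so this is a matrix
  factorization in which the second matrix is upper unitriangular. The conditional stands for
  a binomial coefficient with negative lower argument; truncated subtraction would give \<open>1\<close> there.
\<close>
lemma choose_shift_expansion:
  "(a + j) choose l = (\<Sum>t\<le>j. (if t \<le> l then a choose (l - t) else 0) * (j choose t))"
proof -
  have "(a + j) choose l = (\<Sum>t\<le>l. (j choose t) * (a choose (l - t)))"
    by (simp add: vandermonde add.commute)
  also have "\<dots> = (\<Sum>t\<le>max j l. (if t \<le> l then a choose (l - t) else 0) * (j choose t))"
    by (rule sum.mono_neutral_cong_left) auto
  also have "\<dots> = (\<Sum>t\<le>j. (if t \<le> l then a choose (l - t) else 0) * (j choose t))"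
    by (rule sum.mono_neutral_right) auto
  finally show ?thesis .
qed

lemma D_eq_prod:
  assumes "r > 0"
  shows "D n k r b p =
    (\<Prod>m\<le>n. fact ((n - m) * p + b + (r - 1) * m + k) * fact m /
      (fact (k + m * r) * fact ((n - m) * (p + 1) + b))) *
    (\<Prod>s\<le>n. \<Prod>t\<in>{s<..n}.
      of_nat r * (of_nat b + of_nat n * of_nat p + of_nat t) + (of_nat p + 1) * (of_nat k - of_nat s))"
proof -
  define a where "a m = (n - m) * p + b + (r - 1) * m + k" for m
  define l where "l m = k + m * r" for m
  define w where "w m = (n - m) * (p + 1) + b" for m
  define lin :: "nat \<Rightarrow> nat \<Rightarrow> rat" where
    "lin i j = (\<Prod>t<j. of_nat r * of_nat i + (of_nat k - of_nat t)) *
      (\<Prod>t\<in>{j<..n}. (of_nat b + of_nat n * of_nat p + of_nat t) - (of_nat p + 1) * of_nat i)" for i j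
  have awl: "a i + n = w i + l i" if i: "i \<le> n" for i
  proof -
    obtain q where q: "r = Suc q" using assms by (cases r) auto
    obtain d where "n = i + d" using i le_Suc_ex by blast
    with q show ?thesis by (simp add: a_def w_def l_def algebra_simps)
  qed
  have entry: "nat (upper_arg n k r b p (Suc i) (Suc j)) = a i + j" if i: "i \<le> n" for i j
  proof -
    have "upper_arg n k r b p (Suc i) (Suc j) = int (a i + j)"
    proof -
      obtain q where q: "r = Suc q" using assms by (cases r) auto
      obtain d where "n = i + d" using i le_Suc_ex by blast
      with q show ?thesis by (simp add: a_def upper_arg_def algebra_simps)
    qed
    then show ?thesis by simp
  qed
  have "D n k r b p = det (mat (Suc n) (Suc n) (\<lambda>(i, j). of_nat ((a i + j) choose l i)))"
    unfolding D_def by (intro arg_cong[of _ _ det] eq_matI) (auto simp: entry lower_arg_def l_def)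
  also have "\<dots> =
      det (mat (Suc n) (Suc n) (\<lambda>(i, j). of_nat (if j \<le> l i then a i choose (l i - j) else 0))) *
      det (mat (Suc n) (Suc n) (\<lambda>(i, j). of_nat (j choose i)))"
  proof (rule det_mat_factor)
    fix i j assume "j < Suc n"
    have "(a i + j) choose l i =
        (\<Sum>t<Suc n. (if t \<le> l i then a i choose (l i - t) else 0) * (j choose t))"
      unfolding choose_shift_expansion[of "a i" j] using \<open>j < Suc n\<close>
      by (intro sum.mono_neutral_left) auto
    then show "of_nat ((a i + j) choose l i) =
        (\<Sum>t<Suc n. of_nat (if t \<le> l i then a i choose (l i - t) else 0) * (of_nat (j choose t) :: rat))"
      by (simp only: of_nat_sum of_nat_mult)
  qed
  also have "det (mat (Suc n) (Suc n) (\<lambda>(i, j). of_nat (j choose i))) = (1 :: rat)"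
    by (subst det_mat_upper_triangular) auto
  also have "mat (Suc n) (Suc n) (\<lambda>(i, j). of_nat (if j \<le> l i then a i choose (l i - j) else 0)) =
      mat (Suc n) (Suc n) (\<lambda>(i, j). fact (a i) / (fact (l i) * fact (w i)) * lin i j)"
  proof (intro eq_matI)
    fix i j assume "i < dim_row (mat (Suc n) (Suc n) (\<lambda>(i, j). fact (a i) / (fact (l i) * fact (w i)) * lin i j))"
      and "j < dim_col (mat (Suc n) (Suc n) (\<lambda>(i, j). fact (a i) / (fact (l i) * fact (w i)) * lin i j))"
    then have ij: "i \<le> n" "j \<le> n" by simp_all
    have "of_nat (l i) - of_nat t = of_nat r * of_nat i + (of_nat k - of_nat t :: rat)" for t
      by (simp add: l_def)
    moreover have "of_nat (w i) + of_nat t - of_nat n =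
        of_nat b + of_nat n * of_nat p + of_nat t - (of_nat p + 1) * (of_nat i :: rat)" for t
    proof -
      obtain d where "n = i + d" using ij le_Suc_ex by blast
      then show ?thesis by (simp add: w_def algebra_simps)
    qed
    ultimately have "(\<Prod>t<j. of_nat (l i) - of_nat t) * (\<Prod>t\<in>{j<..n}. of_nat (w i) + of_nat t - of_nat n) = lin i j"
      by (simp only: lin_def)
    with binomial_as_linear_forms[OF awl[OF ij(1)] ij(2), where 'a = rat]
    show "mat (Suc n) (Suc n) (\<lambda>(i, j). of_nat (if j \<le> l i then a i choose (l i - j) else 0)) $$ (i, j) =
        mat (Suc n) (Suc n) (\<lambda>(i, j). fact (a i) / (fact (l i) * fact (w i)) * lin i j) $$ (i, j)"
      using ij by simp
  qed simp_all
  also have "det \<dots> = (\<Prod>m\<le>n. fact (a m) / (fact (l m) * fact (w m))) *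
      det (mat (Suc n) (Suc n) (\<lambda>(i, j). lin i j))"
    by (simp only: det_mat_scale_rows lessThan_Suc_atMost)
  also have "det (mat (Suc n) (Suc n) (\<lambda>(i, j). lin i j)) =
    (\<Prod>i\<le>n. \<Prod>s<i. of_nat i - of_nat s) * (\<Prod>s\<le>n. \<Prod>t\<in>{s<..n}.
      of_nat r * (of_nat b + of_nat n * of_nat p + of_nat t) + (of_nat p + 1) * (of_nat k - of_nat s))"
    unfolding lin_def using assms by (intro det_mat_linear_forms) simp
  also have "(\<Prod>i\<le>n. \<Prod>s<i. of_nat i - of_nat s) = (\<Prod>i\<le>n. fact i :: rat)"
    by (simp add: prod_falling_nat)
  finally show ?thesis
    by (simp add: a_def l_def w_def prod.distrib prod_dividef)
qed

section \<open>Comparing the products\<close>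

lemma prod_over_\<A>:
  "(\<Prod>(i, j)\<in>\<A> n k r. f i j) = (\<Prod>m\<le>n. \<Prod>i\<in>{n - m<..k + (r - 1) * m}. f i (n - m))"
proof -
  have "(\<Prod>m\<le>n. \<Prod>i\<in>{n - m<..k + (r - 1) * m}. f i (n - m)) =
      (\<Prod>(m, i)\<in>(SIGMA m:{..n}. {n - m<..k + (r - 1) * m}). f i (n - m))"
    by (rule prod.Sigma) auto
  also have "\<dots> = (\<Prod>(i, j)\<in>\<A> n k r. f i j)"
    by (rule prod.reindex_bij_witness[of _ "\<lambda>(i, j). (n - j, i)" "\<lambda>(m, i). (i, n - m)"])
      (auto simp: \<A>_def)
  finally show ?thesis by simp
qed

text \<open>
  The pairs \<open>(s, t) = (i - 1, i + j - 1)\<close> with \<open>(i, j)\<close> in \<open>\<B>\<close> are those with \<open>s < t \<le> n\<close> and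
  \<open>s\<close> not of the form \<open>k + r m\<close>. In the last product the factors with \<open>k + r m \<ge> n\<close> are empty.
\<close>
lemma prod_pairs_split_\<B>:
  assumes "r > 0"
  shows "(\<Prod>s\<le>n. \<Prod>t\<in>{s<..n}. f s t) =
    (\<Prod>(i, j)\<in>\<B> n k r. f (i - 1) (i + j - 1)) *
    (\<Prod>m\<le>n. \<Prod>t\<in>{k + r * m<..n}. f (k + r * m) t)"
proof -
  define S where "S = {s \<in> {..n}. \<forall>m. s \<noteq> k + r * m}"
  define T where "T = {m \<in> {..n}. k + r * m \<le> n}"
  have inj: "inj_on (\<lambda>m. k + r * m) T"
    using assms by (auto simp: inj_on_def)
  have "m \<le> r * m" for m using assms by simp
  then have mem: "m \<le> n" if "k + r * m \<le> n" for m
    using that by (meson le_trans le_add2)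
  have pred_eq: "i - Suc 0 = y \<longleftrightarrow> i = Suc y" if "Suc 0 \<le> i" for i y
    using that by auto
  have "(\<Prod>s\<le>n. \<Prod>t\<in>{s<..n}. f s t) =
      (\<Prod>s\<in>S \<union> (\<lambda>m. k + r * m) ` T. \<Prod>t\<in>{s<..n}. f s t)"
    by (rule prod.cong) (auto simp: S_def T_def intro: mem)
  also have "\<dots> = (\<Prod>s\<in>S. \<Prod>t\<in>{s<..n}. f s t) *
      (\<Prod>s\<in>(\<lambda>m. k + r * m) ` T. \<Prod>t\<in>{s<..n}. f s t)"
    by (rule prod.union_disjoint) (auto simp: S_def T_def)
  also have "(\<Prod>s\<in>(\<lambda>m. k + r * m) ` T. \<Prod>t\<in>{s<..n}. f s t) =
      (\<Prod>m\<in>T. \<Prod>t\<in>{k + r * m<..n}. f (k + r * m) t)"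
    by (simp add: prod.reindex[OF inj])
  also have "\<dots> = (\<Prod>m\<le>n. \<Prod>t\<in>{k + r * m<..n}. f (k + r * m) t)"
  proof (rule prod.mono_neutral_left)
    show "\<forall>m\<in>{..n} - T. (\<Prod>t\<in>{k + r * m<..n}. f (k + r * m) t) = 1"
    proof
      fix m assume "m \<in> {..n} - T"
      then have "{k + r * m<..n} = {}" by (auto simp: T_def)
      then show "(\<Prod>t\<in>{k + r * m<..n}. f (k + r * m) t) = 1" by simp
    qed
  qed (auto simp: T_def)
  also have "(\<Prod>s\<in>S. \<Prod>t\<in>{s<..n}. f s t) = (\<Prod>(s, t)\<in>(SIGMA s:S. {s<..n}). f s t)"
    by (rule prod.Sigma) (auto simp: S_def)
  also have "\<dots> = (\<Prod>(i, j)\<in>\<B> n k r. f (i - 1) (i + j - 1))"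
    by (rule prod.reindex_bij_witness[of _ "\<lambda>(i, j). (i - 1, i + j - 1)" "\<lambda>(s, t). (s + 1, t - s)"])
      (auto simp: \<B>_def S_def pred_eq)
  finally show ?thesis .
qed

lemma prod_eq_fact_quotient:
  assumes "m \<le> n"
  shows "(\<Prod>i\<in>{m<..n}. of_nat (x + i)) = (fact (x + n) / fact (x + m) :: 'a::field_char_0)"
  using assms
proof (induction n rule: dec_induct)
  case (step n)
  then have "{m<..Suc n} = insert (Suc n) {m<..n}" by auto
  with step show ?case by (simp add: field_simps)
qed simp

text \<open>At least one of the two ranges is empty; the quotient of the two products is the same
  expression in factorials in both cases.\<close>
lemma prod_telescope_fact:
  "(\<Prod>i\<in>{J<..U}. of_nat (x + i) / of_nat i) =
    (\<Prod>i\<in>{U<..J}. of_nat (x + i) / of_nat i) *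
    (fact (x + U) * fact J / (fact (x + J) * fact U) :: 'a::field_char_0)"
proof (cases "J \<le> U")
  case True
  then show ?thesis
    using prod_eq_fact_quotient[OF True, of x, where 'a = 'a]
      prod_eq_fact_quotient[OF True, of 0, where 'a = 'a]
    by (simp add: prod_dividef)
next
  case False
  then have "U \<le> J" by simp
  then show ?thesis
    using prod_eq_fact_quotient[of U J x, where 'a = 'a]
      prod_eq_fact_quotient[of U J 0, where 'a = 'a]
    by (simp add: prod_dividef)
qed

lemma prod_denominators:
  assumes "r > 0"
  shows "(\<Prod>s\<le>n. \<Prod>t\<in>{s<..n}. of_nat k - of_nat s + of_nat t * of_nat r) =
    (\<Prod>t\<le>n. fact (k + t * r) / fact (k + (r - 1) * t) :: 'a::field_char_0)"
proof -
  have "(\<Prod>s\<le>n. \<Prod>t\<in>{s<..n}. of_nat k - of_nat s + of_nat t * of_nat r :: 'a) =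
      (\<Prod>(s, t)\<in>(SIGMA s:{..n}. {s<..n}). of_nat k - of_nat s + of_nat t * of_nat r)"
    by (rule prod.Sigma) auto
  also have "\<dots> = (\<Prod>(t, s)\<in>(SIGMA t:{..n}. {..<t}). of_nat (k + t * r) - of_nat s)"
    by (rule prod.reindex_bij_witness[of _ prod.swap prod.swap]) auto
  also have "\<dots> = (\<Prod>t\<le>n. \<Prod>s<t. of_nat (k + t * r) - of_nat s)"
    by (rule prod.Sigma[symmetric]) auto
  also have "\<dots> = (\<Prod>t\<le>n. fact (k + t * r) / fact (k + (r - 1) * t))"
  proof (rule prod.cong[OF refl])
    fix t
    obtain q where "r = Suc q" using assms by (cases r) auto
    then have "t \<le> k + t * r" "k + t * r - t = k + (r - 1) * t"
      by (simp_all add: mult.commute)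
    then show "(\<Prod>s<t. of_nat (k + t * r) - of_nat s) =
        (fact (k + t * r) / fact (k + (r - 1) * t) :: 'a)"
      by (simp only: prod_falling_nat if_True)
  qed
  finally show ?thesis .
qed

theorem theorem5p9:
  fixes n k r p b :: nat
  assumes "n > 0" and "k > 0" and "r > 0" and "r \<le> p + 1"
  shows "D n k r b p =
    (\<Prod>(i, j)\<in>\<A> n k r. (of_nat i + of_nat b + of_nat j * of_nat p) / of_nat i) *
    (\<Prod>(i, j)\<in>\<B> n k r.
       ((of_nat k - of_nat i + 1) * (of_nat p + 1) + (of_nat i + of_nat j - 1) * of_nat r
          + of_nat r * (of_nat b + of_nat n * of_nat p))
       / (of_nat k - of_nat i + 1 + (of_nat i + of_nat j - 1) * of_nat r))"
proof -
  define U where "U m = k + (r - 1) * m" for m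
  define x where "x m = (n - m) * p + b" for m
  \<comment> \<open>Numerator and denominator of the second product at \<open>(i, j) = (s + 1, t - s)\<close>.\<close>
  define num :: "nat \<Rightarrow> nat \<Rightarrow> rat" where
    "num s t = of_nat r * (of_nat b + of_nat n * of_nat p + of_nat t) +
      (of_nat p + 1) * (of_nat k - of_nat s)" for s t
  define den :: "nat \<Rightarrow> nat \<Rightarrow> rat" where
    "den s t = of_nat k - of_nat s + of_nat t * of_nat r" for s t
  define Q :: "nat \<Rightarrow> rat" where
    "Q m = (\<Prod>i\<in>{U m<..n - m}. of_nat (x m + i) / of_nat i)" for m
  let ?A = "\<Prod>(i, j)\<in>\<A> n k r. (of_nat i + of_nat b + of_nat j * of_nat p) / (of_nat i :: rat)"
  let ?B = "\<Prod>(i, j)\<in>\<B> n k r. num (i - 1) (i + j - 1) / den (i - 1) (i + j - 1)"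
  have B: "(\<Prod>(i, j)\<in>\<B> n k r.
       ((of_nat k - of_nat i + 1) * (of_nat p + 1) + (of_nat i + of_nat j - 1) * of_nat r
          + of_nat r * (of_nat b + of_nat n * of_nat p))
       / (of_nat k - of_nat i + 1 + (of_nat i + of_nat j - 1) * of_nat r)) = ?B"
  proof (rule prod.cong[OF refl], clarify)
    fix i j assume "(i, j) \<in> \<B> n k r"
    then have i: "of_nat (i - 1) = (of_nat i - 1 :: rat)"
        "of_nat (i + j - 1) = (of_nat i + of_nat j - 1 :: rat)"
      by (auto simp: \<B>_def)
    have "num (i - 1) (i + j - 1) =
        (of_nat k - of_nat i + 1) * (of_nat p + 1) + (of_nat i + of_nat j - 1) * of_nat r
          + of_nat r * (of_nat b + of_nat n * of_nat p)"
      unfolding num_def i by (simp add: algebra_simps)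
    moreover have "den (i - 1) (i + j - 1) =
        of_nat k - of_nat i + 1 + (of_nat i + of_nat j - 1) * of_nat r"
      unfolding den_def i by (simp add: algebra_simps)
    ultimately show "((of_nat k - of_nat i + 1) * (of_nat p + 1) + (of_nat i + of_nat j - 1) * of_nat r
          + of_nat r * (of_nat b + of_nat n * of_nat p))
       / (of_nat k - of_nat i + 1 + (of_nat i + of_nat j - 1) * of_nat r) =
       num (i - 1) (i + j - 1) / den (i - 1) (i + j - 1)"
      by simp
  qed
  \<comment> \<open>On the pairs omitted by \<open>\<B>\<close> a common factor \<open>r\<close> cancels.\<close>
  have "(\<Prod>t\<in>{k + r * m<..n}. num (k + r * m) t / den (k + r * m) t) = Q m" if m: "m \<le> n" for m
    unfolding Q_def
  proof (rule prod.reindex_bij_witness[of _ "\<lambda>i. i + m" "\<lambda>t. t - m"])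
    obtain q where q: "r = Suc q" using assms by (cases r) auto
    fix t assume t: "t \<in> {k + r * m<..n}"
    then have mt: "m < t" by (simp add: q)
    then show "t - m + m = t" "t - m \<in> {U m<..n - m}"
      using t by (auto simp: U_def q)
    have "num (k + r * m) t = of_nat r * of_nat (x m + (t - m))"
    proof -
      obtain d where "n = m + d" using m le_Suc_ex by blast
      with mt show ?thesis by (simp add: num_def x_def algebra_simps)
    qed
    moreover have "den (k + r * m) t = of_nat r * of_nat (t - m)"
      using mt by (simp add: den_def algebra_simps)
    ultimately show "of_nat (x m + (t - m)) / of_nat (t - m) =
        num (k + r * m) t / den (k + r * m) t"
      using assms by (simp del: of_nat_add of_nat_diff)
  next
    fix i assume "i \<in> {U m<..n - m}"
    moreover obtain q where "r = Suc q" using assms by (cases r) auto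
    ultimately show "i + m - m = i" "i + m \<in> {k + r * m<..n}"
      by (auto simp: U_def)
  qed
  then have "(\<Prod>s\<le>n. \<Prod>t\<in>{s<..n}. num s t / den s t) = ?B * (\<Prod>m\<le>n. Q m)"
    by (subst prod_pairs_split_\<B>[OF assms(3), of _ n k]) simp
  moreover have "(\<Prod>s\<le>n. \<Prod>t\<in>{s<..n}. den s t) = (\<Prod>m\<le>n. fact (k + m * r) / fact (U m))"
    unfolding den_def U_def by (rule prod_denominators[OF assms(3)])
  ultimately have B_Q: "?B * (\<Prod>m\<le>n. Q m) =
      (\<Prod>s\<le>n. \<Prod>t\<in>{s<..n}. num s t) * (\<Prod>m\<le>n. fact (U m) / fact (k + m * r))"
    by (simp add: prod_dividef)
  have "?A = (\<Prod>m\<le>n. \<Prod>i\<in>{n - m<..U m}. of_nat (x m + i) / of_nat i)"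
    unfolding prod_over_\<A> U_def x_def by (simp add: ac_simps)
  also have "\<dots> = (\<Prod>m\<le>n. Q m) *
      (\<Prod>m\<le>n. fact (x m + U m) * fact (n - m) / (fact (x m + (n - m)) * fact (U m)))"
    unfolding Q_def prod.distrib[symmetric] by (intro prod.cong refl prod_telescope_fact)
  finally have "?A * ?B = (\<Prod>s\<le>n. \<Prod>t\<in>{s<..n}. num s t) *
      (\<Prod>m\<le>n. fact (U m) / fact (k + m * r)) *
      (\<Prod>m\<le>n. fact (x m + U m) * fact (n - m) / (fact (x m + (n - m)) * fact (U m)))"
    by (simp add: B_Q[symmetric] mult_ac)
  also have "\<dots> = (\<Prod>s\<le>n. \<Prod>t\<in>{s<..n}. num s t) *
      (\<Prod>m\<le>n. fact (x m + U m) / (fact (k + m * r) * fact (x m + (n - m)))) *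
      (\<Prod>m\<le>n. fact (n - m))"
    by (simp add: mult.assoc flip: prod.distrib)
  also have "(\<Prod>m\<le>n. fact (n - m)) = (\<Prod>m\<le>n. fact m :: rat)"
    by (rule prod.reindex_bij_witness[of _ "\<lambda>m. n - m" "\<lambda>m. n - m"]) auto
  also have "(\<Prod>s\<le>n. \<Prod>t\<in>{s<..n}. num s t) *
      (\<Prod>m\<le>n. fact (x m + U m) / (fact (k + m * r) * fact (x m + (n - m)))) *
      (\<Prod>m\<le>n. fact m) = D n k r b p"
    unfolding D_eq_prod[OF assms(3)] num_def x_def U_def
    by (simp add: ac_simps prod_dividef prod.distrib)
  finally show ?thesis
    unfolding B by simp
qed

end
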